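(* Let $n\ge 2$, let $M,N\in\mathbb{Z}^{n-1}$ and let $D=(D_1,\dots,D_{n-1})$ be a tuple of positive integers. Then the long Weyl element Kloosterman sums satisfy $S_n(M,N;D)=S_n(N,M;D)$.
   Context: Definition of $S_n(M,N;D)$: $e(z)=e^{2\pi i z}$. $U$ is the group of upper triangular unipotent $n\times n$ matrices. For $N\in\mathbb{Z}^{n-1}$, $\psi_N$ is the character of $U(\mathbb{R})$, trivial on $U(\mathbb{Z})$, given by $\psi_N(u)=e(N_1u_{1,2}+N_2u_{2,3}+\cdots+N_{n-1}u_{n-1,n})$. For $M\in \mathbb{Z}^{n-1}$, $\tilde M=(M_{n-1},\dots,M_1)$. Let $w_0$ be the long Weyl element: the $n\times n$ matrix whose only nonzero entries are on the anti-diagonal, the entry at position $(n-k+1,k)$ being $(-1)^{k-1}$ ($1\le k\le n$). Let $c=\mathrm{Diag}(1/D_{n-1},\,D_{n-1}/D_{n-2},\dots,D_2/D_1,\,D_1)$, $C(c)=U(\mathbb{R})\,c\,w_0\,U(\mathbb{R})\cap SL(n,\mathbb{Z})$ and $X(c)=U(\mathbb{Z})\backslash C(c)/U(\mathbb{Z})$. Each $\gamma\in C(c)$ is uniquely $\gamma=b_1cw_0b_2$ with $b_1,b_2\in U(\mathbb{R})$; set $\mu(\gamma)=b_1\in U(\mathbb{Z})\backslash U(\mathbb{R})$ and $\mu'(\gamma)=b_2\in U(\mathbb{R})/U(\mathbb{Z})$. Then $$S_n(M,N;D)=\sum_{x\in X(c)}\psi_{\tilde M}(\mu(x))\,\psi_N(\mu'(x)).$$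 *)

theory Defs
  imports Complex_Main "Jordan_Normal_Form.Determinant"
begin

text \<open>
  Matrices are indexed from \<open>0\<close>, so the entry \<open>u\<^sub>k\<^sub>,\<^sub>k\<^sub>+\<^sub>1\<close> of the usual notation is \<open>u $$ (k - 1, k)\<close>.
  Tuples of length \<open>n - 1\<close> are functions on \<^typ>\<open>nat\<close> of which only the values at
  \<open>1, \<dots>, n - 1\<close> are used.
\<close>

definition e :: "complex \<Rightarrow> complex" where
  "e z = exp (2 * of_real pi * \<i> * z)"

definition U_real :: "nat \<Rightarrow> real mat set" where
  "U_real n = {u \<in> carrier_mat n n. upper_triangular u \<and> (\<forall>i<n. u $$ (i, i) = 1)}"

definition U_int :: "nat \<Rightarrow> real mat set" where
  "U_int n = {u \<in> U_real n. elements_mat u \<subseteq> \<int>}"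

definition SL_int :: "nat \<Rightarrow> real mat set" where
  "SL_int n = {A \<in> carrier_mat n n. elements_mat A \<subseteq> \<int> \<and> det A = 1}"

definition \<psi> :: "nat \<Rightarrow> (nat \<Rightarrow> int) \<Rightarrow> real mat \<Rightarrow> complex" where
  "\<psi> n N u = e (of_real (\<Sum>k=1..n-1. of_int (N k) * u $$ (k - 1, k)))"

definition rev_tuple :: "nat \<Rightarrow> (nat \<Rightarrow> int) \<Rightarrow> nat \<Rightarrow> int" where
  "rev_tuple n M = (\<lambda>k. M (n - k))"

definition w0 :: "nat \<Rightarrow> real mat" where
  "w0 n = mat n n (\<lambda>(i, j). if i + j = n - 1 then (-1) ^ j else 0)"

text \<open>
  With the convention \<open>D\<^sub>0 = D\<^sub>n = 1\<close>, the \<open>k\<close>-th diagonal entry (counted from \<open>1\<close>) of \<open>c\<close> is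
  \<open>D\<^sub>n\<^sub>-\<^sub>k\<^sub>+\<^sub>1 / D\<^sub>n\<^sub>-\<^sub>k\<close>.
\<close>

definition c_mat :: "nat \<Rightarrow> (nat \<Rightarrow> int) \<Rightarrow> real mat" where
  "c_mat n D =
     (let D' = (\<lambda>k. if k = 0 \<or> k = n then 1 else real_of_int (D k))
      in mat_diag n (\<lambda>i. D' (n - i) / D' (n - i - 1)))"

definition big_cell :: "nat \<Rightarrow> (nat \<Rightarrow> int) \<Rightarrow> real mat set" where
  "big_cell n D =
     {b1 * c_mat n D * w0 n * b2 | b1 b2. b1 \<in> U_real n \<and> b2 \<in> U_real n} \<inter> SL_int n"

definition X_cosets :: "nat \<Rightarrow> (nat \<Rightarrow> int) \<Rightarrow> real mat set set" where
  "X_cosets n D =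
     (\<lambda>\<gamma>. {u * \<gamma> * v | u v. u \<in> U_int n \<and> v \<in> U_int n}) ` big_cell n D"

definition bruhat_left :: "nat \<Rightarrow> (nat \<Rightarrow> int) \<Rightarrow> real mat \<Rightarrow> real mat" where
  "bruhat_left n D \<gamma> =
     (THE b1. b1 \<in> U_real n \<and> (\<exists>b2\<in>U_real n. \<gamma> = b1 * c_mat n D * w0 n * b2))"

definition bruhat_right :: "nat \<Rightarrow> (nat \<Rightarrow> int) \<Rightarrow> real mat \<Rightarrow> real mat" where
  "bruhat_right n D \<gamma> =
     (THE b2. b2 \<in> U_real n \<and> (\<exists>b1\<in>U_real n. \<gamma> = b1 * c_mat n D * w0 n * b2))"

text \<open>\<open>\<mu>\<close> takes values in \<open>U(\<int>)\<setminus>U(\<real>)\<close> and \<open>\<mu>'\<close> in \<open>U(\<real>)/U(\<int>)\<close>.\<close>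

definition \<mu> :: "nat \<Rightarrow> (nat \<Rightarrow> int) \<Rightarrow> real mat \<Rightarrow> real mat set" where
  "\<mu> n D \<gamma> = {u * bruhat_left n D \<gamma> | u. u \<in> U_int n}"

definition \<mu>' :: "nat \<Rightarrow> (nat \<Rightarrow> int) \<Rightarrow> real mat \<Rightarrow> real mat set" where
  "\<mu>' n D \<gamma> = {bruhat_right n D \<gamma> * v | v. v \<in> U_int n}"

text \<open>
  The common value of \<open>f\<close> on a class \<open>A\<close> on which \<open>f\<close> is constant.  It is used both to let \<open>\<mu>\<close>
  and \<open>\<mu>'\<close> act on double cosets and to let \<open>\<psi>\<close>, being trivial on \<open>U(\<int>)\<close>, act on
  \<open>U(\<int>)\<setminus>U(\<real>)\<close> and \<open>U(\<real>)/U(\<int>)\<close>.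
\<close>

definition on_class :: "('a \<Rightarrow> 'b) \<Rightarrow> 'a set \<Rightarrow> 'b" where
  "on_class f A = the_elem (f ` A)"

definition S_Kloosterman ::
    "nat \<Rightarrow> (nat \<Rightarrow> int) \<Rightarrow> (nat \<Rightarrow> int) \<Rightarrow> (nat \<Rightarrow> int) \<Rightarrow> complex" where
  "S_Kloosterman n M N D =
     (\<Sum>x\<in>X_cosets n D.
        on_class (\<psi> n (rev_tuple n M)) (on_class (\<mu> n D) x) *
        on_class (\<psi> n N) (on_class (\<mu>' n D) x))"

end

theory Submission imports Defs begin

text \<open>
  Reflection in the anti-diagonal, \<open>A \<mapsto> J A\<^sup>T J\<close> with \<open>J\<close> the exchange matrix, is an involutive
  anti-automorphism that preserves \<open>U(\<real>)\<close>, \<open>U(\<int>)\<close> and integrality and fixes \<open>c w\<^sub>0\<close>, because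
  every anti-diagonal matrix is its own reflection.  Hence it sends \<open>b\<^sub>1 c w\<^sub>0 b\<^sub>2\<close> to
  \<open>b\<^sub>2' c w\<^sub>0 b\<^sub>1'\<close> and permutes \<open>X(c)\<close> while exchanging \<open>\<mu>\<close> and \<open>\<mu>'\<close>.  As it reverses the
  superdiagonal, it turns \<open>\<psi>\<^sub>N\<close> into the character of the reversed tuple, and the two
  Kloosterman sums have the same terms.
\<close>

section \<open>Reflection in the anti-diagonal\<close>

text \<open>Given entrywise instead of as \<open>J A^T J\<close>, so that the involution law is a
  computation with indices. The \<open>- 1\<close> terms come from indexing at
  \<open>0\<close>.\<close>

definition antitranspose :: "'a mat \<Rightarrow> 'a mat" where
  "antitranspose A =
     mat (dim_col A) (dim_row A) (\<lambda>(i, j). A $$ (dim_row A - 1 - j, dim_col A - 1 - i))"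

lemma antitranspose_carrier [simp, intro]:
  "A \<in> carrier_mat m n \<Longrightarrow> antitranspose A \<in> carrier_mat n m"
  by (simp add: antitranspose_def)

lemma index_antitranspose:
  "A \<in> carrier_mat m n \<Longrightarrow> i < n \<Longrightarrow> j < m \<Longrightarrow>
     antitranspose A $$ (i, j) = A $$ (m - 1 - j, n - 1 - i)"
  by (simp add: antitranspose_def)

lemma antitranspose_antitranspose [simp]: "antitranspose (antitranspose A) = A"
  by (rule eq_matI) (auto simp: antitranspose_def)

lemma index_mult_mat_sum:
  assumes "A \<in> carrier_mat m l" and "B \<in> carrier_mat l n" and "i < m" and "j < n"
  shows "(A * B) $$ (i, j) = (\<Sum>k<l. A $$ (i, k) * B $$ (k, j))"
  using assms by (auto simp: scalar_prod_def lessThan_atLeast0 intro!: sum.cong)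

text \<open>Reflection reverses the inner summation index, \<open>k\<close> becoming
  \<open>l - 1 - k\<close>; commutativity of the scalars then exchanges the two factors.\<close>

lemma antitranspose_mult:
  fixes A B :: "'a :: comm_semiring_0 mat"
  assumes A: "A \<in> carrier_mat m l" and B: "B \<in> carrier_mat l n"
  shows "antitranspose (A * B) = antitranspose B * antitranspose A"
proof (rule eq_matI)
  fix i j
  assume "i < dim_row (antitranspose B * antitranspose A)"
    and "j < dim_col (antitranspose B * antitranspose A)"
  then have i: "i < n" and j: "j < m"
    using A B by (auto simp: antitranspose_def)
  have AB: "A * B \<in> carrier_mat m n"
    using A B by simp
  have "antitranspose (A * B) $$ (i, j) =
      (\<Sum>k<l. A $$ (m - 1 - j, k) * B $$ (k, n - 1 - i))"
    using i j A B by (simp add: index_antitranspose[OF AB] index_mult_mat_sum[OF A B] del: index_mult_mat)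
  also have "\<dots> = (\<Sum>k<l. A $$ (m - 1 - j, l - 1 - k) * B $$ (l - 1 - k, n - 1 - i))"
    by (subst sum.nat_diff_reindex[symmetric]) simp
  also have "\<dots> = (\<Sum>k<l. antitranspose B $$ (i, k) * antitranspose A $$ (k, j))"
    using i j by (intro sum.cong) (simp_all add: index_antitranspose[OF A] index_antitranspose[OF B] mult.commute)
  also have "\<dots> = (antitranspose B * antitranspose A) $$ (i, j)"
    using i j A B by (subst index_mult_mat_sum) auto
  finally show "antitranspose (A * B) $$ (i, j) = (antitranspose B * antitranspose A) $$ (i, j)" .
qed (use A B in \<open>auto simp: antitranspose_def\<close>)

section \<open>Unipotent groups\<close>

lemma elements_mat_subset_Ints_iff:
  assumes "A \<in> carrier_mat m n"
  shows "elements_mat A \<subseteq> \<int> \<longleftrightarrow> (\<forall>i<m. \<forall>j<n. A $$ (i, j) \<in> \<int>)"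
  using assms by (fastforce simp: elements_mat_def)

lemma elements_mat_mult_Ints:
  fixes A B :: "'a :: ring_1 mat"
  assumes A: "A \<in> carrier_mat m l" "elements_mat A \<subseteq> \<int>"
    and B: "B \<in> carrier_mat l n" "elements_mat B \<subseteq> \<int>"
  shows "elements_mat (A * B) \<subseteq> \<int>"
proof -
  have AB: "A * B \<in> carrier_mat m n"
    using A B by simp
  have "(A * B) $$ (i, j) \<in> \<int>" if "i < m" "j < n" for i j
    unfolding index_mult_mat_sum[OF A(1) B(1) that]
    using that A B
    by (intro Ints_sum Ints_mult) (auto simp: elements_mat_subset_Ints_iff)
  then show ?thesis
    by (simp add: elements_mat_subset_Ints_iff[OF AB])
qed

lemma elements_mat_antitranspose_Ints:
  assumes A: "A \<in> carrier_mat n n" "elements_mat A \<subseteq> \<int>"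
  shows "elements_mat (antitranspose A) \<subseteq> \<int>"
  using A by (auto simp: elements_mat_subset_Ints_iff[of _ n n] index_antitranspose[OF A(1)])

lemma U_real_iff:
  "u \<in> U_real n \<longleftrightarrow> u \<in> carrier_mat n n \<and>
     (\<forall>i<n. \<forall>j<i. u $$ (i, j) = 0) \<and> (\<forall>i<n. u $$ (i, i) = 1)"
  by (auto simp: U_real_def upper_triangular_def)

lemma U_real_carrier: "u \<in> U_real n \<Longrightarrow> u \<in> carrier_mat n n"
  by (simp add: U_real_iff)

lemma U_int_subset_U_real: "u \<in> U_int n \<Longrightarrow> u \<in> U_real n"
  by (simp add: U_int_def)

lemma one_U_int: "1\<^sub>m n \<in> U_int n"
  by (auto simp: U_int_def U_real_iff elements_mat_subset_Ints_iff[of _ n n])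

lemma U_real_mult:
  assumes u: "u \<in> U_real n" and v: "v \<in> U_real n"
  shows "u * v \<in> U_real n"
proof -
  note c = U_real_carrier[OF u] U_real_carrier[OF v]
  have "(u * v) $$ (i, j) = 0" if "i < n" "j < i" for i j
  proof -
    have "u $$ (i, k) * v $$ (k, j) = 0" if "k < n" for k
      using u v \<open>i < n\<close> \<open>j < i\<close> that by (cases "k < i") (auto simp: U_real_iff)
    then show ?thesis
      using that by (subst index_mult_mat_sum[OF c]) (auto intro!: sum.neutral simp del: mult_eq_0_iff)
  qed
  moreover have "(u * v) $$ (i, i) = 1" if i: "i < n" for i
  proof -
    have "u $$ (i, k) * v $$ (k, i) = (if k = i then 1 else 0)" if "k < n" for k
      using u v i that by (cases k i rule: linorder_cases) (auto simp: U_real_iff)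
    then show ?thesis
      using i by (subst index_mult_mat_sum[OF c]) auto
  qed
  ultimately show ?thesis
    using c by (auto simp: U_real_iff simp del: index_mult_mat(1))
qed

lemma U_int_mult: "u \<in> U_int n \<Longrightarrow> v \<in> U_int n \<Longrightarrow> u * v \<in> U_int n"
  by (simp add: U_int_def U_real_mult elements_mat_mult_Ints[of _ n n _ n] U_real_carrier)

lemma det_U_real:
  assumes "u \<in> U_real n"
  shows "det u = 1"
proof -
  have "det u = prod_list (diag_mat u)"
    using assms by (intro det_upper_triangular) (auto simp: U_real_def)
  also have "\<dots> = 1"
    using assms by (auto simp: prod_list_diag_prod U_real_iff)
  finally show ?thesis .
qed

text \<open>Column \<open>j\<close> of \<open>b * u = 1\<close> expresses \<open>b $$ (i, j)\<close> through the entries of \<open>b\<close> in the earlier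
  columns, so triangularity and integrality of \<open>b\<close> follow by induction on \<open>j\<close>.\<close>

lemma U_real_left_inverse_index:
  assumes u: "u \<in> U_real n" and b: "b \<in> carrier_mat n n" and bu: "b * u = 1\<^sub>m n"
    and i: "i < n" and j: "j < n"
  shows "b $$ (i, j) = (if i = j then 1 else 0) - (\<Sum>k<j. b $$ (i, k) * u $$ (k, j))"
proof -
  have "(if i = j then 1 else 0) = (b * u) $$ (i, j)"
    using i j by (simp add: bu)
  also have "\<dots> = (\<Sum>k<n. b $$ (i, k) * u $$ (k, j))"
    using i j by (intro index_mult_mat_sum[OF b U_real_carrier[OF u]])
  also have "\<dots> = (\<Sum>k<Suc j. b $$ (i, k) * u $$ (k, j))"
    using u j by (intro sum.mono_neutral_right) (auto simp: U_real_iff)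
  also have "\<dots> = (\<Sum>k<j. b $$ (i, k) * u $$ (k, j)) + b $$ (i, j)"
    using u j by (simp add: U_real_iff)
  finally show ?thesis
    by simp
qed

lemma U_real_inverse:
  assumes u: "u \<in> U_real n"
  obtains b where "b \<in> U_real n" "b * u = 1\<^sub>m n" "u * b = 1\<^sub>m n" "u \<in> U_int n \<Longrightarrow> b \<in> U_int n"
proof
  \<comment> \<open>Since \<open>det u = 1\<close>, the adjugate is a two-sided inverse.\<close>
  define b where "b = adj_mat u"
  note c = U_real_carrier[OF u]
  show bu: "b * u = 1\<^sub>m n" and "u * b = 1\<^sub>m n"
    using adj_mat(2,3)[OF c] by (auto simp: b_def det_U_real[OF u])
  have b: "b \<in> carrier_mat n n"
    using adj_mat(1)[OF c] by (simp add: b_def)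
  note ix = U_real_left_inverse_index[OF u b bu]
  have lower: "b $$ (i, j) = 0" if "i < n" "j < i" for i j
    using that
  proof (induction j rule: less_induct)
    case (less j)
    then show ?case
      using ix[of i j] by simp
  qed
  have "b $$ (i, i) = 1" if "i < n" for i
    using ix[of i i] lower[of i] that by simp
  with lower b show bU: "b \<in> U_real n"
    by (auto simp: U_real_iff)
  assume "u \<in> U_int n"
  then have int: "u $$ (i, j) \<in> \<int>" if "i < n" "j < n" for i j
    using c that by (auto simp: U_int_def elements_mat_subset_Ints_iff)
  have "b $$ (i, j) \<in> \<int>" if "i < n" "j < n" for i j
    using that
  proof (induction j rule: less_induct)
    case (less j)
    then show ?case
      by (subst ix) (auto intro!: Ints_diff Ints_sum Ints_mult int)
  qed
  then show "b \<in> U_int n"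
    using b bU by (auto simp: U_int_def elements_mat_subset_Ints_iff)
qed

text \<open>Surjectivity comes from \<open>v = (v * b) * u\<close> with \<open>b\<close> the
  integral inverse of \<open>u\<close>. This is what makes the coset of \<open>b1\<close> modulo
  \<open>U_int n\<close> insensitive to replacing \<open>b1\<close> by
  \<open>u * b1\<close>.\<close>

lemma U_int_right_translate:
  assumes u: "u \<in> U_int n"
  shows "(\<lambda>v. v * u) ` U_int n = U_int n"
proof
  show "(\<lambda>v. v * u) ` U_int n \<subseteq> U_int n"
    using u by (auto intro: U_int_mult)
  obtain b where b: "b \<in> U_int n" "b * u = 1\<^sub>m n"
    using U_real_inverse[OF U_int_subset_U_real[OF u]] u by metis
  show "U_int n \<subseteq> (\<lambda>v. v * u) ` U_int n"
  proof
    fix v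
    assume v: "v \<in> U_int n"
    have "v = v * b * u"
      using b v u by (simp add: assoc_mult_mat[of v n n b n u n] U_real_carrier U_int_subset_U_real
          right_mult_one_mat[of v n n])
    then show "v \<in> (\<lambda>v. v * u) ` U_int n"
      using v b by (blast intro: U_int_mult)
  qed
qed

text \<open>The position \<open>(i, j)\<close> is exchanged with
  \<open>(n - 1 - j, n - 1 - i)\<close>, which has the same difference of column and row, so each
  diagonal is mapped to itself.\<close>

lemma antitranspose_U_real: "u \<in> U_real n \<Longrightarrow> antitranspose u \<in> U_real n"
  by (auto simp: U_real_iff index_antitranspose[of u n n])

lemma antitranspose_U_int: "u \<in> U_int n \<Longrightarrow> antitranspose u \<in> U_int n"
  by (simp add: U_int_def antitranspose_U_real elements_mat_antitranspose_Ints[of _ n]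
      U_real_carrier)

text \<open>The superdiagonal position \<open>(k - 1, k)\<close> is exchanged with
  \<open>(n - k - 1, n - k)\<close>, so the sum is reindexed by \<open>k\<close> to
  \<open>n - k\<close>.\<close>

lemma \<psi>_antitranspose:
  assumes "u \<in> carrier_mat n n"
  shows "\<psi> n N (antitranspose u) = \<psi> n (rev_tuple n N) u"
proof -
  have "(\<Sum>k=1..n-1. of_int (N k) * antitranspose u $$ (k - 1, k)) =
      (\<Sum>k=1..n-1. of_int (rev_tuple n N k) * u $$ (k - 1, k))"
    by (rule sum.reindex_bij_witness[of _ "\<lambda>k. n - k" "\<lambda>k. n - k"])
      (auto simp: rev_tuple_def index_antitranspose[OF assms] diff_right_commute)
  then show ?thesis
    by (simp add: \<psi>_def)
qed

section \<open>The Bruhat decomposition of the big cell\<close>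

text \<open>For an anti-diagonal \<open>w\<close> with nonzero entries, \<open>u w = w v\<close> makes \<open>u\<close> both upper and lower
  triangular.\<close>

lemma antidiagonal_intertwine_U_real:
  assumes w: "w = mat n n (\<lambda>(i, j). if i + j = n - 1 then d i else 0)"
    and d: "\<And>i. i < n \<Longrightarrow> d i \<noteq> 0"
    and u: "u \<in> U_real n" and v: "v \<in> U_real n" and eq: "u * w = w * v"
  shows "u = 1\<^sub>m n"
proof -
  have wc: "w \<in> carrier_mat n n"
    by (simp add: w)
  have "u $$ (i, k) = 0" if ik: "i < k" "k < n" for i k
  proof -
    have less: "i < n" "n - 1 - k < n"
      using ik by auto
    \<comment> \<open>Column \<open>n - 1 - k\<close> of \<open>w\<close> has its only nonzero entry
      in row \<open>k\<close>; likewise, row \<open>i\<close> of \<open>w\<close> has its only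
      nonzero entry in column \<open>n - 1 - i\<close>.\<close>
    have "(u * w) $$ (i, n - 1 - k) = (\<Sum>l<n. if l = k then u $$ (i, k) * d k else 0)"
      unfolding index_mult_mat_sum[OF U_real_carrier[OF u] wc less]
      using ik by (intro sum.cong refl) (auto simp: w)
    moreover have "(w * v) $$ (i, n - 1 - k) =
        (\<Sum>l<n. if l = n - 1 - i then d i * v $$ (n - 1 - i, n - 1 - k) else 0)"
      unfolding index_mult_mat_sum[OF wc U_real_carrier[OF v] less]
      using ik by (intro sum.cong refl) (auto simp: w)
    \<comment> \<open>As \<open>i < k\<close>, this position lies strictly below the
      diagonal.\<close>
    moreover have "v $$ (n - 1 - i, n - 1 - k) = 0"
      using v ik by (auto simp: U_real_iff)
    ultimately show ?thesis
      using eq ik d by simp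
  qed
  then show ?thesis
    using u by (intro eq_matI) (auto simp: U_real_iff, metis linorder_neqE_nat)
qed

locale long_element =
  fixes n :: nat and D :: "nat \<Rightarrow> int"
  assumes D_pos: "\<forall>k\<in>{1..n-1}. D k > 0"
begin

definition cw0 :: "real mat" where
  "cw0 = c_mat n D * w0 n"

lemma cw0_antidiagonal:
  obtains d where "cw0 = mat n n (\<lambda>(i, j). if i + j = n - 1 then d i else 0)"
    and "\<And>i. i < n \<Longrightarrow> d i \<noteq> 0"
proof -
  define D' where "D' = (\<lambda>k. if k = 0 \<or> k = n then 1 else real_of_int (D k))"
  \<comment> \<open>The sign in \<open>w0\<close> depends on the column, which on the anti-diagonal
    is \<open>n - 1 - i\<close>. Positivity of the \<open>D k\<close> makes both parts of the
    quotient nonzero.\<close>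
  define d where "d = (\<lambda>i. D' (n - i) / D' (n - i - 1) * (-1) ^ (n - 1 - i))"
  have D': "D' k \<noteq> 0" if "k \<le> n" for k
  proof (cases "k = 0 \<or> k = n")
    case False
    with that have "D k > 0"
      by (intro bspec[OF D_pos]) auto
    with False show ?thesis
      by (simp add: D'_def)
  qed (auto simp: D'_def)
  have w0: "w0 n \<in> carrier_mat n n"
    by (simp add: w0_def)
  have "cw0 = mat n n (\<lambda>(i, j). D' (n - i) / D' (n - i - 1) * w0 n $$ (i, j))"
    unfolding cw0_def c_mat_def Let_def D'_def[symmetric] by (rule mat_diag_mult_left[OF w0])
  also have "\<dots> = mat n n (\<lambda>(i, j). if i + j = n - 1 then d i else 0)"
  proof (rule cong_mat[OF refl refl], goal_cases)
    case (1 i j)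
    have "j = n - 1 - i" if "i + j = n - 1"
      using that by simp
    then show ?case
      using 1 by (auto simp: w0_def d_def)
  qed
  finally show thesis
    by (rule that) (simp add: d_def D')
qed

lemma cw0_carrier: "cw0 \<in> carrier_mat n n"
  by (rule cw0_antidiagonal) simp

text \<open>Every position with \<open>i + j = n - 1\<close> is fixed by the reflection. The product
  is thus fixed, while the diagonal of \<open>c_mat n D\<close> alone would be reversed.\<close>

lemma antitranspose_cw0: "antitranspose cw0 = cw0"
proof -
  obtain d where d: "cw0 = mat n n (\<lambda>(i, j). if i + j = n - 1 then d i else 0)"
    using cw0_antidiagonal by blast
  show ?thesis
    by (rule eq_matI) (auto simp: d antitranspose_def intro: arg_cong[of _ _ d])
qed

lemma bruhat_assoc:
  assumes "b1 \<in> U_real n" and "b2 \<in> U_real n"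
  shows "b1 * c_mat n D * w0 n * b2 = b1 * cw0 * b2"
proof -
  have "b1 * c_mat n D * w0 n = b1 * cw0"
    using U_real_carrier[OF assms(1)] unfolding cw0_def
    by (intro assoc_mult_mat) (auto simp: c_mat_def w0_def Let_def)
  then show ?thesis
    by simp
qed

lemma big_cell_iff:
  "\<gamma> \<in> big_cell n D \<longleftrightarrow>
     (\<exists>b1\<in>U_real n. \<exists>b2\<in>U_real n. \<gamma> = b1 * cw0 * b2) \<and> \<gamma> \<in> SL_int n"
  unfolding big_cell_def Int_iff mem_Collect_eq by (metis bruhat_assoc)

text \<open>Multiplying by the inverses \<open>a\<close> of \<open>b1'\<close> and \<open>f\<close>
  of \<open>b2\<close> turns the equation into \<open>(a * b1) * cw0 = cw0 * (b2' * f)\<close>, and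
  the intertwining lemma gives \<open>a * b1 = 1\<close>.\<close>

lemma bruhat_unique_left:
  assumes b: "b1 \<in> U_real n" "b2 \<in> U_real n" "b1' \<in> U_real n" "b2' \<in> U_real n"
    and eq: "b1 * cw0 * b2 = b1' * cw0 * b2'"
  shows "b1 = b1'"
proof -
  obtain a where a: "a \<in> U_real n" "a * b1' = 1\<^sub>m n" "b1' * a = 1\<^sub>m n"
    using U_real_inverse[OF b(3)] by metis
  obtain f where f: "f \<in> U_real n" "b2 * f = 1\<^sub>m n"
    using U_real_inverse[OF b(2)] by metis
  note c = b[THEN U_real_carrier] a(1)[THEN U_real_carrier] f(1)[THEN U_real_carrier] cw0_carrier
  have "a * b1 * cw0 = a * b1 * cw0 * (b2 * f)"
    using c f by (metis mult_carrier_mat right_mult_one_mat)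
  also have "\<dots> = a * (b1 * cw0 * b2) * f"
    using c by (simp add: assoc_mult_mat[where ?n\<^sub>1.0=n and ?n\<^sub>2.0=n and ?n\<^sub>3.0=n and ?n\<^sub>4.0=n])
  also have "\<dots> = (a * b1') * cw0 * (b2' * f)"
    using c unfolding eq by (simp add: assoc_mult_mat[where ?n\<^sub>1.0=n and ?n\<^sub>2.0=n and ?n\<^sub>3.0=n and ?n\<^sub>4.0=n])
  also have "\<dots> = cw0 * (b2' * f)"
    using c a by simp
  finally have inter: "a * b1 * cw0 = cw0 * (b2' * f)" .
  obtain d where "cw0 = mat n n (\<lambda>(i, j). if i + j = n - 1 then d i else 0)"
    "\<And>i. i < n \<Longrightarrow> d i \<noteq> 0"
    using cw0_antidiagonal by blast
  then have "a * b1 = 1\<^sub>m n"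
    by (rule antidiagonal_intertwine_U_real) (use a f b inter in \<open>auto intro: U_real_mult\<close>)
  then have "b1' * (a * b1) = b1'"
    using c by simp
  moreover have "b1' * (a * b1) = (b1' * a) * b1"
    using c by (intro assoc_mult_mat[symmetric])
  ultimately show ?thesis
    using a c by simp
qed

lemma bruhat_left_eq:
  assumes "b1 \<in> U_real n" and "b2 \<in> U_real n"
  shows "bruhat_left n D (b1 * cw0 * b2) = b1"
  unfolding bruhat_left_def
proof (rule the_equality)
  show "b1 \<in> U_real n \<and> (\<exists>b2'\<in>U_real n. b1 * cw0 * b2 = b1 * c_mat n D * w0 n * b2')"
    using assms bruhat_assoc by metis
  fix b
  assume "b \<in> U_real n \<and> (\<exists>b2'\<in>U_real n. b1 * cw0 * b2 = b * c_mat n D * w0 n * b2')"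
  then show "b = b1"
    using assms bruhat_assoc bruhat_unique_left by metis
qed

lemma antitranspose_bruhat:
  assumes "b1 \<in> U_real n" and "b2 \<in> U_real n"
  shows "antitranspose (b1 * cw0 * b2) = antitranspose b2 * cw0 * antitranspose b1"
proof -
  note c = assms[THEN U_real_carrier] cw0_carrier
  then show ?thesis
    by (simp add: antitranspose_mult[of _ n n _ n] antitranspose_cw0)
qed

text \<open>Reflection makes the right factors into left factors, to which
  \<open>bruhat_unique_left\<close> applies.\<close>

lemma bruhat_unique_right:
  assumes b: "b1 \<in> U_real n" "b2 \<in> U_real n" "b1' \<in> U_real n" "b2' \<in> U_real n"
    and eq: "b1 * cw0 * b2 = b1' * cw0 * b2'"
  shows "b2 = b2'"
proof -
  have "antitranspose b2 * cw0 * antitranspose b1 = antitranspose b2' * cw0 * antitranspose b1'"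
    using eq b by (simp add: antitranspose_bruhat[symmetric])
  then have "antitranspose b2 = antitranspose b2'"
    by (rule bruhat_unique_left[rotated 4]) (use b in \<open>auto intro: antitranspose_U_real\<close>)
  then show ?thesis
    by (metis antitranspose_antitranspose)
qed

lemma bruhat_right_eq:
  assumes "b1 \<in> U_real n" and "b2 \<in> U_real n"
  shows "bruhat_right n D (b1 * cw0 * b2) = b2"
  unfolding bruhat_right_def
proof (rule the_equality)
  show "b2 \<in> U_real n \<and> (\<exists>b1'\<in>U_real n. b1 * cw0 * b2 = b1' * c_mat n D * w0 n * b2)"
    using assms bruhat_assoc by metis
  fix b
  assume "b \<in> U_real n \<and> (\<exists>b1'\<in>U_real n. b1 * cw0 * b2 = b1' * c_mat n D * w0 n * b)"
  then show "b = b2"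
    using assms bruhat_assoc bruhat_unique_right by metis
qed

lemma antitranspose_big_cell:
  assumes "\<gamma> \<in> big_cell n D"
  shows "antitranspose \<gamma> \<in> big_cell n D"
proof -
  obtain b1 b2 where b: "b1 \<in> U_real n" "b2 \<in> U_real n" "\<gamma> = b1 * cw0 * b2"
    and SL: "\<gamma> \<in> SL_int n"
    using assms by (auto simp: big_cell_iff)
  note b' = antitranspose_U_real[OF b(1)] antitranspose_U_real[OF b(2)]
  \<comment> \<open>Both \<open>\<gamma>\<close> and its reflection have this shape, so their
    determinants agree.\<close>
  have det: "det (u * cw0 * v) = det cw0" if "u \<in> U_real n" "v \<in> U_real n" for u v
    using that[THEN U_real_carrier] cw0_carrier
    by (simp add: det_mult[of _ n] det_U_real[OF that(1)] det_U_real[OF that(2)])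
  have at: "antitranspose \<gamma> = antitranspose b2 * cw0 * antitranspose b1"
    using b by (simp add: antitranspose_bruhat)
  have "det (antitranspose \<gamma>) = det \<gamma>"
    unfolding at using b b' by (simp add: det)
  then have "antitranspose \<gamma> \<in> SL_int n"
    using SL elements_mat_antitranspose_Ints by (auto simp: SL_int_def)
  then show ?thesis
    using at b' by (auto simp: big_cell_iff)
qed

section \<open>Double cosets\<close>

definition double_coset :: "real mat \<Rightarrow> real mat set" where
  "double_coset \<gamma> = {u * \<gamma> * v | u v. u \<in> U_int n \<and> v \<in> U_int n}"

lemma X_cosets_eq: "X_cosets n D = double_coset ` big_cell n D"
  by (simp add: X_cosets_def double_coset_def)

lemma big_cell_carrier: "\<gamma> \<in> big_cell n D \<Longrightarrow> \<gamma> \<in> carrier_mat n n"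
  by (simp add: big_cell_def SL_int_def)

lemma mem_double_coset: "\<gamma> \<in> big_cell n D \<Longrightarrow> \<gamma> \<in> double_coset \<gamma>"
  unfolding double_coset_def using one_U_int[of n] big_cell_carrier[of \<gamma>]
  by (auto intro!: exI[of _ "1\<^sub>m n"])

lemma antitranspose_double_coset:
  assumes "\<gamma> \<in> big_cell n D"
  shows "antitranspose ` double_coset \<gamma> = double_coset (antitranspose \<gamma>)"
proof -
  have sub: "antitranspose ` double_coset \<gamma> \<subseteq> double_coset (antitranspose \<gamma>)"
    if "\<gamma> \<in> big_cell n D" for \<gamma>
  proof
    fix y
    assume "y \<in> antitranspose ` double_coset \<gamma>"
    then obtain u v where uv: "u \<in> U_int n" "v \<in> U_int n" "y = antitranspose (u * \<gamma> * v)"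
      by (auto simp: double_coset_def)
    note c = uv(1,2)[THEN U_int_subset_U_real, THEN U_real_carrier] big_cell_carrier[OF that]
    have "y = antitranspose v * antitranspose \<gamma> * antitranspose u"
      using c uv(3) by (simp add: antitranspose_mult[of _ n n _ n])
    then show "y \<in> double_coset (antitranspose \<gamma>)"
      using uv antitranspose_U_int by (auto simp: double_coset_def)
  qed
  \<comment> \<open>The inclusion \<open>sub\<close> is applied to the reflected element; reflecting
    once more yields the converse inclusion.\<close>
  have "antitranspose ` double_coset (antitranspose \<gamma>) \<subseteq> double_coset \<gamma>"
    using sub[OF antitranspose_big_cell[OF assms]] by simp
  then have "double_coset (antitranspose \<gamma>) \<subseteq> antitranspose ` double_coset \<gamma>"
    by (metis antitranspose_antitranspose image_subset_iff rev_image_eqI subsetI)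
  then show ?thesis
    using sub[OF assms] by blast
qed

lemma antitranspose_X_cosets: "x \<in> X_cosets n D \<Longrightarrow> antitranspose ` x \<in> X_cosets n D"
  unfolding X_cosets_eq using antitranspose_double_coset antitranspose_big_cell by auto

section \<open>Cosets of the Bruhat factors and their behavior under reflection\<close>

lemma \<mu>_bruhat:
  assumes "b1 \<in> U_real n" and "b2 \<in> U_real n"
  shows "\<mu> n D (b1 * cw0 * b2) = (\<lambda>u. u * b1) ` U_int n"
  by (auto simp: \<mu>_def bruhat_left_eq[OF assms])

lemma \<mu>'_bruhat:
  assumes "b1 \<in> U_real n" and "b2 \<in> U_real n"
  shows "\<mu>' n D (b1 * cw0 * b2) = (\<lambda>u. b2 * u) ` U_int n"
  by (auto simp: \<mu>'_def bruhat_right_eq[OF assms])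

text \<open>The reflection of \<open>b2\<close> is the left factor of the reflected element;
  reflecting its coset puts \<open>U_int n\<close> back on the right of \<open>b2\<close>. Questions
  on \<open>\<mu>'\<close> thereby reduce to \<open>\<mu>\<close>.\<close>

lemma \<mu>'_eq_antitranspose_\<mu>:
  assumes "b1 \<in> U_real n" and "b2 \<in> U_real n"
  shows "\<mu>' n D (b1 * cw0 * b2) = antitranspose ` \<mu> n D (antitranspose (b1 * cw0 * b2))"
proof -
  have U: "antitranspose ` U_int n = U_int n"
    by (metis antitranspose_U_int antitranspose_antitranspose image_subset_iff rev_image_eqI
        subsetI subset_antisym)
  have "antitranspose ` \<mu> n D (antitranspose (b1 * cw0 * b2)) =
      (\<lambda>u. antitranspose (u * antitranspose b2)) ` U_int n"
    using assms by (simp add: antitranspose_bruhat \<mu>_bruhat antitranspose_U_real image_image)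
  also have "\<dots> = (\<lambda>u. b2 * antitranspose u) ` U_int n"
    using assms U_real_carrier U_int_subset_U_real
    by (intro image_cong refl, subst antitranspose_mult[of _ n n _ n]) auto
  also have "\<dots> = (\<lambda>u. b2 * u) ` antitranspose ` U_int n"
    by (simp add: image_image)
  finally show ?thesis
    by (simp add: U \<mu>'_bruhat[OF assms])
qed

text \<open>The element \<open>u * \<gamma> * v\<close> has Bruhat factors \<open>u * b1\<close> and
  \<open>b2 * v\<close>, and the integral \<open>u\<close> is absorbed by the coset of
  \<open>b1\<close>.\<close>

lemma double_coset_bruhat:
  assumes "\<gamma> \<in> big_cell n D" and "\<delta> \<in> double_coset \<gamma>"
  obtains b1 b2 where "b1 \<in> U_real n" "b2 \<in> U_real n" "\<delta> = b1 * cw0 * b2" "\<mu> n D \<delta> = \<mu> n D \<gamma>"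
proof -
  obtain b1 b2 where b: "b1 \<in> U_real n" "b2 \<in> U_real n" "\<gamma> = b1 * cw0 * b2"
    using assms(1) by (auto simp: big_cell_iff)
  obtain u v where uv: "u \<in> U_int n" "v \<in> U_int n" "\<delta> = u * \<gamma> * v"
    using assms(2) by (auto simp: double_coset_def)
  note uv' = uv(1,2)[THEN U_int_subset_U_real]
  note c = b(1,2)[THEN U_real_carrier] uv'[THEN U_real_carrier] cw0_carrier
  have U: "u * b1 \<in> U_real n" "b2 * v \<in> U_real n"
    using b uv' U_real_mult by auto
  have \<delta>: "\<delta> = u * b1 * cw0 * (b2 * v)"
    using c by (simp add: b(3) uv(3) assoc_mult_mat[where ?n\<^sub>1.0=n and ?n\<^sub>2.0=n and ?n\<^sub>3.0=n and ?n\<^sub>4.0=n])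
  have "\<mu> n D \<delta> = (\<lambda>u'. u' * (u * b1)) ` U_int n"
    by (simp add: \<delta> \<mu>_bruhat U)
  also have "\<dots> = (\<lambda>u'. u' * u * b1) ` U_int n"
    using c by (intro image_cong refl assoc_mult_mat[of _ n n _ n _ n, symmetric])
      (simp_all add: U_real_carrier U_int_subset_U_real)
  also have "\<dots> = (\<lambda>u'. u' * b1) ` (\<lambda>u'. u' * u) ` U_int n"
    by (simp add: image_image)
  also have "\<dots> = \<mu> n D \<gamma>"
    by (simp add: U_int_right_translate[OF uv(1)] b \<mu>_bruhat)
  finally show thesis
    using U \<delta> that by blast
qed

text \<open>The image passed to \<open>the_elem\<close> is a singleton: \<open>\<mu>\<close> is
  constant on the double coset, which contains \<gamma>.\<close>

lemma on_class_\<mu>: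
  assumes "\<gamma> \<in> big_cell n D"
  shows "on_class (\<mu> n D) (double_coset \<gamma>) = \<mu> n D \<gamma>"
proof -
  have "\<mu> n D ` double_coset \<gamma> = {\<mu> n D \<gamma>}"
    using double_coset_bruhat[OF assms] mem_double_coset[OF assms] by blast
  then show ?thesis
    by (simp add: on_class_def)
qed

lemma on_class_\<mu>':
  assumes "x \<in> X_cosets n D"
  shows "on_class (\<mu>' n D) x = antitranspose ` on_class (\<mu> n D) (antitranspose ` x)"
proof -
  obtain \<gamma> where \<gamma>: "\<gamma> \<in> big_cell n D" "x = double_coset \<gamma>"
    using assms by (auto simp: X_cosets_eq)
  note at = antitranspose_big_cell[OF \<gamma>(1)]
  have "\<mu>' n D \<delta> = antitranspose ` \<mu> n D (antitranspose \<gamma>)" if "\<delta> \<in> x" for \<delta>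
  proof -
    have "antitranspose \<delta> \<in> double_coset (antitranspose \<gamma>)"
      using that \<gamma> antitranspose_double_coset by blast
    then have "\<mu> n D (antitranspose \<delta>) = \<mu> n D (antitranspose \<gamma>)"
      using double_coset_bruhat[OF at] by metis
    moreover have "\<mu>' n D \<delta> = antitranspose ` \<mu> n D (antitranspose \<delta>)"
      using double_coset_bruhat[OF \<gamma>(1)] that \<gamma>(2) \<mu>'_eq_antitranspose_\<mu> by metis
    ultimately show ?thesis
      by simp
  qed
  then have "\<mu>' n D ` x = {antitranspose ` \<mu> n D (antitranspose \<gamma>)}"
    using mem_double_coset \<gamma> by blast
  then show ?thesis
    using \<gamma> by (simp add: on_class_def[of "\<mu>' n D"] antitranspose_double_coset on_class_\<mu>[OF at])
qed

text \<open>Supplies the dimension hypothesis of \<open>\<psi>_antitranspose\<close> for the members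
  of a coset.\<close>

lemma on_class_\<mu>_carrier:
  assumes "x \<in> X_cosets n D"
  shows "on_class (\<mu> n D) x \<subseteq> carrier_mat n n"
proof -
  obtain \<gamma> where \<gamma>: "\<gamma> \<in> big_cell n D" "x = double_coset \<gamma>"
    using assms by (auto simp: X_cosets_eq)
  then obtain b1 b2 where "b1 \<in> U_real n" "b2 \<in> U_real n" "\<gamma> = b1 * cw0 * b2"
    by (auto simp: big_cell_iff)
  then show ?thesis
    using \<gamma> by (auto simp: on_class_\<mu> \<mu>_bruhat
        dest!: U_int_subset_U_real U_real_carrier intro!: mult_carrier_mat)
qed

text \<open>The two characters have the same image set on the two cosets, so \<open>the_elem\<close>
  returns the same value.\<close>

lemma on_class_\<psi>_\<mu>':
  assumes x: "x \<in> X_cosets n D"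
  shows "on_class (\<psi> n N) (on_class (\<mu>' n D) x) =
    on_class (\<psi> n (rev_tuple n N)) (on_class (\<mu> n D) (antitranspose ` x))"
proof -
  have "(\<lambda>u. \<psi> n N (antitranspose u)) ` on_class (\<mu> n D) (antitranspose ` x) =
      \<psi> n (rev_tuple n N) ` on_class (\<mu> n D) (antitranspose ` x)"
    using on_class_\<mu>_carrier[OF antitranspose_X_cosets[OF x]]
    by (intro image_cong refl \<psi>_antitranspose) auto
  then show ?thesis
    by (simp add: on_class_\<mu>'[OF x] on_class_def[of "\<psi> n _"] image_image)
qed

lemma S_Kloosterman_commute: "S_Kloosterman n M N D = S_Kloosterman n N M D"
proof -
  \<comment> \<open>With \<open>f\<close>, both factors of a term are expressed through
    \<open>\<mu>\<close>, the second one at the reflected double coset. Reindexing by the involution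
    exchanges \<open>M\<close> and \<open>N\<close>.\<close>
  define f where "f = (\<lambda>M x. on_class (\<psi> n (rev_tuple n M)) (on_class (\<mu> n D) x))"
  have S: "S_Kloosterman n M N D = (\<Sum>x\<in>X_cosets n D. f M x * f N (antitranspose ` x))" for M N
    unfolding S_Kloosterman_def f_def by (intro sum.cong refl) (simp add: on_class_\<psi>_\<mu>')
  show ?thesis
    unfolding S
    by (rule sum.reindex_bij_witness[of _ "image antitranspose" "image antitranspose"])
      (auto simp: image_image antitranspose_X_cosets)
qed

end

theorem proposition3p3:
  fixes n :: nat and M N D :: "nat \<Rightarrow> int"
  assumes "n \<ge> 2" and "\<forall>k\<in>{1..n-1}. D k > 0"
  shows "S_Kloosterman n M N D = S_Kloosterman n N M D"
proof -
  interpret long_element n D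
    by unfold_locales (rule assms(2))
  show ?thesis
    by (rule S_Kloosterman_commute)
qed

end
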